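(* Let $(P^*,P_* )$ be an adjoint pair of functors between categories $\mathcal B$ and $\mathcal C$ ($P^*\colon\mathcal B\to\mathcal C$ left adjoint to $P_*\colon\mathcal C\to\mathcal B$). Suppose that $\mathcal B$ is Karoubian complete. If the natural morphism of functors $\eta\colon\mathrm{Id}_{\mathcal B}\to P_*P^*$ splits (i.e. has a left inverse natural transformation $P_*P^*\to\mathrm{Id}_{\mathcal B}$), then the comparison functor $\Phi\colon\mathcal B\to\mathcal C_{\mathsf T}$ is an equivalence, where $\mathsf T$ is the comonad on $\mathcal C$ associated with $(P^*,P_* )$.
   Context: A category $\mathcal B$ is Karoubian complete if every projector splits: for any $f\colon H\to H$ with $f^2=f$ there are an object $H'$ and morphisms $\sigma\colon H'\to H$, $\rho\colon H\to H'$ with $\rho\sigma=\mathrm{Id}_{H'}$, $\sigma\rho=f$. The comonad associated with the adjoint pair is $\mathsf T=(T,\varepsilon,\delta)$ with $T=P^*P_*$, $\varepsilon\colon P^*P_*\to\mathrm{Id}_{\mathcal C}$ the counit, $\delta=P^*\eta P_*\colon T\to TT$. $\mathcal C_{\mathsf T}$ is the category of $\mathsf T$-comodules: objects are pairs $(F,h)$, $F\in\mathcal C$, $h\colon F\to TF$ with $\varepsilon_F\circ h=\mathrm{Id}_F$ and $Th\circ h=\delta_F\circ h$; morphisms $(F_1,h_1)\to(F_2,h_2)$ are morphisms $f\colon F_1\to F_2$ in $\mathcal C$ with $Tf\circ h_1=h_2\circ f$. The comparison functor is $\Phi(H)=(P^*H,P^*\eta_H)$, $\Phi(f)=P^*f$.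 *)

theory Defs
  imports Main
begin

section \<open>Categories\<close>

record ('o, 'm) cat =
  Obj :: "'o set"
  Arr :: "'m set"
  Dom :: "'m \<Rightarrow> 'o"
  Cod :: "'m \<Rightarrow> 'o"
  Ident :: "'o \<Rightarrow> 'm"
  Comp :: "'m \<Rightarrow> 'm \<Rightarrow> 'm"  (infixr "\<odot>\<index>" 70)

definition hom :: "('o, 'm) cat \<Rightarrow> 'o \<Rightarrow> 'o \<Rightarrow> 'm set"
  where "hom C x y = {f \<in> Arr C. Dom C f = x \<and> Cod C f = y}"

locale category =
  fixes C :: "('o, 'm) cat" (structure)
  assumes Dom_in_Obj: "f \<in> Arr C \<Longrightarrow> Dom C f \<in> Obj C"
    and Cod_in_Obj: "f \<in> Arr C \<Longrightarrow> Cod C f \<in> Obj C"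
    and Id_in_hom: "x \<in> Obj C \<Longrightarrow> Ident C x \<in> hom C x x"
    and Comp_in_hom: "f \<in> hom C x y \<Longrightarrow> g \<in> hom C y z \<Longrightarrow> g \<odot> f \<in> hom C x z"
    and Comp_Id_left: "f \<in> hom C x y \<Longrightarrow> Ident C y \<odot> f = f"
    and Comp_Id_right: "f \<in> hom C x y \<Longrightarrow> f \<odot> Ident C x = f"
    and Comp_assoc: "f \<in> hom C w x \<Longrightarrow> g \<in> hom C x y \<Longrightarrow> h \<in> hom C y z
          \<Longrightarrow> (h \<odot> g) \<odot> f = h \<odot> (g \<odot> f)"

definition karoubian_complete :: "('o, 'm) cat \<Rightarrow> bool"
  where "karoubian_complete B \<longleftrightarrow>
    (\<forall>H \<in> Obj B. \<forall>f \<in> hom B H H. f \<odot>\<^bsub>B\<^esub> f = f \<longrightarrow>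
      (\<exists>H' \<in> Obj B. \<exists>\<sigma> \<in> hom B H' H. \<exists>\<rho> \<in> hom B H H'.
        \<rho> \<odot>\<^bsub>B\<^esub> \<sigma> = Ident B H' \<and> \<sigma> \<odot>\<^bsub>B\<^esub> \<rho> = f))"

definition iso_arr :: "('o, 'm) cat \<Rightarrow> 'm \<Rightarrow> bool"
  where "iso_arr C f \<longleftrightarrow> f \<in> Arr C \<and>
    (\<exists>g \<in> hom C (Cod C f) (Dom C f).
      g \<odot>\<^bsub>C\<^esub> f = Ident C (Dom C f) \<and> f \<odot>\<^bsub>C\<^esub> g = Ident C (Cod C f))"

section \<open>Functors and natural transformations\<close>

record ('o1, 'm1, 'o2, 'm2) cfun =
  on_obj :: "'o1 \<Rightarrow> 'o2"
  on_arr :: "'m1 \<Rightarrow> 'm2"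

locale cat_functor = A: category A + B: category B
  for A :: "('o1, 'm1) cat" and B :: "('o2, 'm2) cat"
    and F :: "('o1, 'm1, 'o2, 'm2) cfun" +
  assumes on_obj_in_Obj: "x \<in> Obj A \<Longrightarrow> on_obj F x \<in> Obj B"
    and on_arr_in_hom: "f \<in> hom A x y \<Longrightarrow> on_arr F f \<in> hom B (on_obj F x) (on_obj F y)"
    and on_arr_Id: "x \<in> Obj A \<Longrightarrow> on_arr F (Ident A x) = Ident B (on_obj F x)"
    and on_arr_Comp: "f \<in> hom A x y \<Longrightarrow> g \<in> hom A y z
          \<Longrightarrow> on_arr F (g \<odot>\<^bsub>A\<^esub> f) = on_arr F g \<odot>\<^bsub>B\<^esub> on_arr F f"

definition id_fun :: "('o, 'm, 'o, 'm) cfun"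
  where "id_fun = \<lparr>on_obj = (\<lambda>x. x), on_arr = (\<lambda>f. f)\<rparr>"

definition comp_fun ::
    "('o2, 'm2, 'o3, 'm3) cfun \<Rightarrow> ('o1, 'm1, 'o2, 'm2) cfun \<Rightarrow> ('o1, 'm1, 'o3, 'm3) cfun"
    (infixr "\<circ>\<^sub>F" 55)
  where "G \<circ>\<^sub>F F = \<lparr>on_obj = on_obj G \<circ> on_obj F, on_arr = on_arr G \<circ> on_arr F\<rparr>"

locale nat_trans = F: cat_functor A B F + G: cat_functor A B G
  for A :: "('o1, 'm1) cat" and B :: "('o2, 'm2) cat"
    and F G :: "('o1, 'm1, 'o2, 'm2) cfun" and \<tau> :: "'o1 \<Rightarrow> 'm2" +
  assumes component: "x \<in> Obj A \<Longrightarrow> \<tau> x \<in> hom B (on_obj F x) (on_obj G x)"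
    and naturality: "f \<in> hom A x y
          \<Longrightarrow> \<tau> y \<odot>\<^bsub>B\<^esub> on_arr F f = on_arr G f \<odot>\<^bsub>B\<^esub> \<tau> x"

definition nat_iso ::
    "('o1, 'm1) cat \<Rightarrow> ('o2, 'm2) cat \<Rightarrow> ('o1, 'm1, 'o2, 'm2) cfun
      \<Rightarrow> ('o1, 'm1, 'o2, 'm2) cfun \<Rightarrow> ('o1 \<Rightarrow> 'm2) \<Rightarrow> bool"
  where "nat_iso A B F G \<tau> \<longleftrightarrow> nat_trans A B F G \<tau> \<and> (\<forall>x \<in> Obj A. iso_arr B (\<tau> x))"

definition is_equivalence ::
    "('o1, 'm1) cat \<Rightarrow> ('o2, 'm2) cat \<Rightarrow> ('o1, 'm1, 'o2, 'm2) cfun \<Rightarrow> bool"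
  where "is_equivalence A B F \<longleftrightarrow> cat_functor A B F \<and>
    (\<exists>G \<alpha> \<beta>. cat_functor B A G \<and>
      nat_iso A A id_fun (G \<circ>\<^sub>F F) \<alpha> \<and> nat_iso B B (F \<circ>\<^sub>F G) id_fun \<beta>)"

definition nat_splits ::
    "('o1, 'm1) cat \<Rightarrow> ('o2, 'm2) cat \<Rightarrow> ('o1, 'm1, 'o2, 'm2) cfun
      \<Rightarrow> ('o1, 'm1, 'o2, 'm2) cfun \<Rightarrow> ('o1 \<Rightarrow> 'm2) \<Rightarrow> bool"
  where "nat_splits A B F G \<tau> \<longleftrightarrow>
    (\<exists>\<zeta>. nat_trans A B G F \<zeta> \<and> (\<forall>x \<in> Obj A. \<zeta> x \<odot>\<^bsub>B\<^esub> \<tau> x = Ident B (on_obj F x)))"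

locale adjunction =
  L: cat_functor B C L + R: cat_functor C B R +
  unit: nat_trans B B id_fun "R \<circ>\<^sub>F L" \<eta> +
  counit: nat_trans C C "L \<circ>\<^sub>F R" id_fun \<epsilon>
  for B :: "('o1, 'm1) cat" and C :: "('o2, 'm2) cat"
    and L :: "('o1, 'm1, 'o2, 'm2) cfun" and R :: "('o2, 'm2, 'o1, 'm1) cfun"
    and \<eta> :: "'o1 \<Rightarrow> 'm1" and \<epsilon> :: "'o2 \<Rightarrow> 'm2" +
  assumes triangle_left: "H \<in> Obj B
          \<Longrightarrow> \<epsilon> (on_obj L H) \<odot>\<^bsub>C\<^esub> on_arr L (\<eta> H) = Ident C (on_obj L H)"
    and triangle_right: "F \<in> Obj C
          \<Longrightarrow> on_arr R (\<epsilon> F) \<odot>\<^bsub>B\<^esub> \<eta> (on_obj R F) = Ident B (on_obj R F)"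

section \<open>Comonads and comodules\<close>

record ('o, 'm) comonad_data =
  Endo :: "('o, 'm, 'o, 'm) cfun"
  Counit :: "'o \<Rightarrow> 'm"
  Comult :: "'o \<Rightarrow> 'm"

locale comonad =
  category C +
  counit: nat_trans C C "Endo T" id_fun "Counit T" +
  comult: nat_trans C C "Endo T" "Endo T \<circ>\<^sub>F Endo T" "Comult T"
  for C :: "('o, 'm) cat" and T :: "('o, 'm) comonad_data" +
  assumes counit_left: "F \<in> Obj C
          \<Longrightarrow> Counit T (on_obj (Endo T) F) \<odot>\<^bsub>C\<^esub> Comult T F = Ident C (on_obj (Endo T) F)"
    and counit_right: "F \<in> Obj C
          \<Longrightarrow> on_arr (Endo T) (Counit T F) \<odot>\<^bsub>C\<^esub> Comult T F = Ident C (on_obj (Endo T) F)"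
    and coassoc: "F \<in> Obj C
          \<Longrightarrow> on_arr (Endo T) (Comult T F) \<odot>\<^bsub>C\<^esub> Comult T F
            = Comult T (on_obj (Endo T) F) \<odot>\<^bsub>C\<^esub> Comult T F"

definition comodules :: "('o, 'm) cat \<Rightarrow> ('o, 'm) comonad_data \<Rightarrow> ('o \<times> 'm) set"
  where "comodules C T = {(F, h). F \<in> Obj C \<and> h \<in> hom C F (on_obj (Endo T) F) \<and>
    Counit T F \<odot>\<^bsub>C\<^esub> h = Ident C F \<and>
    on_arr (Endo T) h \<odot>\<^bsub>C\<^esub> h = Comult T F \<odot>\<^bsub>C\<^esub> h}"

text \<open>A morphism of comodules is stored together with its source and target, since the
  same morphism of \<open>C\<close> may underlie morphisms between different comodules.\<close>

definition comodule_cat ::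
    "('o, 'm) cat \<Rightarrow> ('o, 'm) comonad_data
      \<Rightarrow> ('o \<times> 'm, ('o \<times> 'm) \<times> 'm \<times> ('o \<times> 'm)) cat"
  where "comodule_cat C T =
    \<lparr>Obj = comodules C T,
     Arr = {(X, f, Y). X \<in> comodules C T \<and> Y \<in> comodules C T \<and>
              f \<in> hom C (fst X) (fst Y) \<and>
              on_arr (Endo T) f \<odot>\<^bsub>C\<^esub> snd X = snd Y \<odot>\<^bsub>C\<^esub> f},
     Dom = (\<lambda>(X, f, Y). X),
     Cod = (\<lambda>(X, f, Y). Y),
     Ident = (\<lambda>X. (X, Ident C (fst X), X)),
     Comp = (\<lambda>(Y, g, Z) (X, f, Y'). (X, g \<odot>\<^bsub>C\<^esub> f, Z))\<rparr>"

section \<open>The comonad of an adjoint pair and the comparison functor\<close>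

definition adj_comonad ::
    "('o1, 'm1, 'o2, 'm2) cfun \<Rightarrow> ('o2, 'm2, 'o1, 'm1) cfun
      \<Rightarrow> ('o1 \<Rightarrow> 'm1) \<Rightarrow> ('o2 \<Rightarrow> 'm2) \<Rightarrow> ('o2, 'm2) comonad_data"
  where "adj_comonad L R \<eta> \<epsilon> =
    \<lparr>Endo = L \<circ>\<^sub>F R, Counit = \<epsilon>, Comult = (\<lambda>F. on_arr L (\<eta> (on_obj R F)))\<rparr>"

definition comparison ::
    "('o1, 'm1) cat \<Rightarrow> ('o1, 'm1, 'o2, 'm2) cfun \<Rightarrow> ('o1 \<Rightarrow> 'm1)
      \<Rightarrow> ('o1, 'm1, 'o2 \<times> 'm2, ('o2 \<times> 'm2) \<times> 'm2 \<times> ('o2 \<times> 'm2)) cfun"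
  where "comparison B L \<eta> =
    (let \<Phi> = (\<lambda>H. (on_obj L H, on_arr L (\<eta> H)))
     in \<lparr>on_obj = \<Phi>, on_arr = (\<lambda>f. (\<Phi> (Dom B f), on_arr L f, \<Phi> (Cod B f)))\<rparr>)"

section \<open>Well-definedness\<close>

lemma on_obj_id_fun [simp]: "on_obj id_fun x = x"
  and on_arr_id_fun [simp]: "on_arr id_fun f = f"
  by (simp_all add: id_fun_def)

lemma on_obj_comp_fun [simp]: "on_obj (G \<circ>\<^sub>F F) x = on_obj G (on_obj F x)"
  and on_arr_comp_fun [simp]: "on_arr (G \<circ>\<^sub>F F) f = on_arr G (on_arr F f)"
  by (simp_all add: comp_fun_def)

lemma cat_functor_comp:
  assumes "cat_functor A B F" "cat_functor B C G"
  shows "cat_functor A C (G \<circ>\<^sub>F F)"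
proof -
  interpret F: cat_functor A B F by fact
  interpret G: cat_functor B C G by fact
  show ?thesis
    by unfold_locales
      (simp_all add: F.on_obj_in_Obj G.on_obj_in_Obj F.on_arr_in_hom G.on_arr_in_hom
        F.on_arr_Id G.on_arr_Id F.on_arr_Comp G.on_arr_Comp[OF F.on_arr_in_hom F.on_arr_in_hom])
qed

context adjunction
begin

lemma comonad_adj_comonad: "comonad C (adj_comonad L R \<eta> \<epsilon>)"
proof -
  have T: "cat_functor C C (L \<circ>\<^sub>F R)"
    by (rule cat_functor_comp[OF R.cat_functor_axioms L.cat_functor_axioms])
  have TT: "cat_functor C C ((L \<circ>\<^sub>F R) \<circ>\<^sub>F L \<circ>\<^sub>F R)"
    by (rule cat_functor_comp[OF T T])
  have eta: "\<eta> (on_obj R F) \<in> hom B (on_obj R F) (on_obj R (on_obj L (on_obj R F)))"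
    if "F \<in> Obj C" for F
    using unit.component[OF R.on_obj_in_Obj[OF that]] by simp
  have eps: "\<epsilon> F \<in> hom C (on_obj L (on_obj R F)) F" if "F \<in> Obj C" for F
    using counit.component[OF that] by simp
  have comult: "nat_trans C C (L \<circ>\<^sub>F R) ((L \<circ>\<^sub>F R) \<circ>\<^sub>F L \<circ>\<^sub>F R) (\<lambda>F. on_arr L (\<eta> (on_obj R F)))"
  proof (intro nat_trans.intro nat_trans_axioms.intro T TT)
    fix F assume "F \<in> Obj C"
    then show "on_arr L (\<eta> (on_obj R F))
        \<in> hom C (on_obj (L \<circ>\<^sub>F R) F) (on_obj ((L \<circ>\<^sub>F R) \<circ>\<^sub>F L \<circ>\<^sub>F R) F)"
      using L.on_arr_in_hom[OF eta] by simp
  next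
    fix f x y assume f: "f \<in> hom C x y"
    then have x: "x \<in> Obj C" and y: "y \<in> Obj C"
      using L.B.Dom_in_Obj L.B.Cod_in_Obj by (auto simp: hom_def)
    note Rf = R.on_arr_in_hom[OF f]
    note RLRf = R.on_arr_in_hom[OF L.on_arr_in_hom[OF Rf]]
    show "on_arr L (\<eta> (on_obj R y)) \<odot>\<^bsub>C\<^esub> on_arr (L \<circ>\<^sub>F R) f
        = on_arr ((L \<circ>\<^sub>F R) \<circ>\<^sub>F L \<circ>\<^sub>F R) f \<odot>\<^bsub>C\<^esub> on_arr L (\<eta> (on_obj R x))"
      using unit.naturality[OF Rf] L.on_arr_Comp[OF Rf eta[OF y]] L.on_arr_Comp[OF eta[OF x] RLRf]
      by simp
  qed
  show ?thesis
  proof (intro comonad.intro comonad_axioms.intro)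
    fix F assume F: "F \<in> Obj C"
    note RF = R.on_obj_in_Obj[OF F]
    let ?T = "adj_comonad L R \<eta> \<epsilon>"
    show "Counit ?T (on_obj (Endo ?T) F) \<odot>\<^bsub>C\<^esub> Comult ?T F = Ident C (on_obj (Endo ?T) F)"
      using triangle_left[OF RF] by (simp add: adj_comonad_def)
    show "on_arr (Endo ?T) (Counit ?T F) \<odot>\<^bsub>C\<^esub> Comult ?T F = Ident C (on_obj (Endo ?T) F)"
      using L.on_arr_Comp[OF eta[OF F] R.on_arr_in_hom[OF eps[OF F]]]
        triangle_right[OF F] L.on_arr_Id[OF RF]
      by (simp add: adj_comonad_def)
    show "on_arr (Endo ?T) (Comult ?T F) \<odot>\<^bsub>C\<^esub> Comult ?T F
        = Comult ?T (on_obj (Endo ?T) F) \<odot>\<^bsub>C\<^esub> Comult ?T F"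
      using unit.naturality[OF eta[OF F]]
        L.on_arr_Comp[OF eta[OF F] eta[OF L.on_obj_in_Obj[OF RF]]]
        L.on_arr_Comp[OF eta[OF F] R.on_arr_in_hom[OF L.on_arr_in_hom[OF eta[OF F]]]]
      by (simp add: adj_comonad_def)
  qed (use L.B.category_axioms comult counit.nat_trans_axioms in \<open>simp_all add: adj_comonad_def\<close>)
qed

end

lemma hom_comodule_cat:
  "hom (comodule_cat C T) X Y =
    {(X, f, Y) | f. X \<in> comodules C T \<and> Y \<in> comodules C T \<and> f \<in> hom C (fst X) (fst Y) \<and>
      on_arr (Endo T) f \<odot>\<^bsub>C\<^esub> snd X = snd Y \<odot>\<^bsub>C\<^esub> f}"
  unfolding hom_def[of "comodule_cat C T"] by (auto simp: comodule_cat_def)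

lemma Comp_comodule_cat [simp]:
  "(Y, g, Z) \<odot>\<^bsub>comodule_cat C T\<^esub> (X, f, Y') = (X, g \<odot>\<^bsub>C\<^esub> f, Z)"
  by (simp add: comodule_cat_def)

lemma Obj_comodule_cat [simp]: "Obj (comodule_cat C T) = comodules C T"
  and Ident_comodule_cat [simp]: "Ident (comodule_cat C T) X = (X, Ident C (fst X), X)"
  by (simp_all add: comodule_cat_def)

lemma (in comonad) category_comodule_cat: "category (comodule_cat C T)"
proof
  have comp: "on_arr (Endo T) (g \<odot>\<^bsub>C\<^esub> f) \<odot>\<^bsub>C\<^esub> h1 = h3 \<odot>\<^bsub>C\<^esub> (g \<odot>\<^bsub>C\<^esub> f)"
    if f: "f \<in> hom C F1 F2" and g: "g \<in> hom C F2 F3"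
      and h: "h1 \<in> hom C F1 (on_obj (Endo T) F1)" "h2 \<in> hom C F2 (on_obj (Endo T) F2)"
        "h3 \<in> hom C F3 (on_obj (Endo T) F3)"
      and f_comm: "on_arr (Endo T) f \<odot>\<^bsub>C\<^esub> h1 = h2 \<odot>\<^bsub>C\<^esub> f"
      and g_comm: "on_arr (Endo T) g \<odot>\<^bsub>C\<^esub> h2 = h3 \<odot>\<^bsub>C\<^esub> g"
    for f g h1 h2 h3 F1 F2 F3
  proof -
    note Tf = counit.F.on_arr_in_hom[OF f] and Tg = counit.F.on_arr_in_hom[OF g]
    have "on_arr (Endo T) (g \<odot>\<^bsub>C\<^esub> f) \<odot>\<^bsub>C\<^esub> h1
        = on_arr (Endo T) g \<odot>\<^bsub>C\<^esub> (on_arr (Endo T) f \<odot>\<^bsub>C\<^esub> h1)"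
      using counit.F.on_arr_Comp[OF f g] Comp_assoc[OF h(1) Tf Tg] by simp
    also have "\<dots> = (on_arr (Endo T) g \<odot>\<^bsub>C\<^esub> h2) \<odot>\<^bsub>C\<^esub> f"
      using Comp_assoc[OF f h(2) Tg] f_comm by simp
    also have "\<dots> = h3 \<odot>\<^bsub>C\<^esub> (g \<odot>\<^bsub>C\<^esub> f)"
      using Comp_assoc[OF f g h(3)] g_comm by simp
    finally show ?thesis .
  qed
  have comod: "fst X \<in> Obj C" "snd X \<in> hom C (fst X) (on_obj (Endo T) (fst X))"
    if "X \<in> comodules C T" for X
    using that by (auto simp: comodules_def)
  show "f \<in> Arr (comodule_cat C T) \<Longrightarrow> Dom (comodule_cat C T) f \<in> Obj (comodule_cat C T)"
    and "f \<in> Arr (comodule_cat C T) \<Longrightarrow> Cod (comodule_cat C T) f \<in> Obj (comodule_cat C T)" for f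
    by (auto simp: comodule_cat_def)
  show "Ident (comodule_cat C T) X \<in> hom (comodule_cat C T) X X"
    if "X \<in> Obj (comodule_cat C T)" for X
    using that comod[of X]
    by (simp add: hom_comodule_cat Id_in_hom counit.F.on_arr_Id Comp_Id_left Comp_Id_right)
  show "g \<odot>\<^bsub>comodule_cat C T\<^esub> f \<in> hom (comodule_cat C T) X Z"
    if "f \<in> hom (comodule_cat C T) X Y" "g \<in> hom (comodule_cat C T) Y Z" for f g X Y Z
    using that comod[of X] comod[of Y] comod[of Z]
    by (auto simp: hom_comodule_cat Comp_in_hom[of _ "fst X" "fst Y"]
        comp[of _ "fst X" "fst Y" _ "fst Z" "snd X" "snd Y" "snd Z"])
  show "Ident (comodule_cat C T) Y \<odot>\<^bsub>comodule_cat C T\<^esub> f = f"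
    and "f \<odot>\<^bsub>comodule_cat C T\<^esub> Ident (comodule_cat C T) X = f"
    if "f \<in> hom (comodule_cat C T) X Y" for f X Y
    using that by (auto simp: hom_comodule_cat Comp_Id_left Comp_Id_right)
  show "(h \<odot>\<^bsub>comodule_cat C T\<^esub> g) \<odot>\<^bsub>comodule_cat C T\<^esub> f
      = h \<odot>\<^bsub>comodule_cat C T\<^esub> (g \<odot>\<^bsub>comodule_cat C T\<^esub> f)"
    if "f \<in> hom (comodule_cat C T) W X" "g \<in> hom (comodule_cat C T) X Y"
      "h \<in> hom (comodule_cat C T) Y Z" for f g h W X Y Z
    using that by (auto simp: hom_comodule_cat Comp_assoc)
qed

lemma (in adjunction) cat_functor_comparison:
  "cat_functor B (comodule_cat C (adj_comonad L R \<eta> \<epsilon>)) (comparison B L \<eta>)"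
proof (intro cat_functor.intro cat_functor_axioms.intro L.A.category_axioms
    comonad.category_comodule_cat[OF comonad_adj_comonad])
  have eta: "\<eta> H \<in> hom B H (on_obj R (on_obj L H))" if "H \<in> Obj B" for H
    using unit.component[OF that] by simp
  have comod: "(on_obj L H, on_arr L (\<eta> H)) \<in> comodules C (adj_comonad L R \<eta> \<epsilon>)"
    if H: "H \<in> Obj B" for H
    using L.on_obj_in_Obj[OF H] L.on_arr_in_hom[OF eta[OF H]] triangle_left[OF H]
      unit.naturality[OF eta[OF H]] L.on_arr_Comp[OF eta[OF H] eta[OF R.on_obj_in_Obj]]
      L.on_arr_Comp[OF eta[OF H] R.on_arr_in_hom[OF L.on_arr_in_hom[OF eta[OF H]]]]
    by (simp add: comodules_def adj_comonad_def)
  show "on_obj (comparison B L \<eta>) x \<in> Obj (comodule_cat C (adj_comonad L R \<eta> \<epsilon>))"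
    if "x \<in> Obj B" for x
    using comod[OF that] by (simp add: comparison_def Let_def)
  show "on_arr (comparison B L \<eta>) f \<in> hom (comodule_cat C (adj_comonad L R \<eta> \<epsilon>))
      (on_obj (comparison B L \<eta>) x) (on_obj (comparison B L \<eta>) y)"
    if f: "f \<in> hom B x y" for f x y
  proof -
    have dc: "Dom B f = x" "Cod B f = y" and x: "x \<in> Obj B" and y: "y \<in> Obj B"
      using f L.A.Dom_in_Obj L.A.Cod_in_Obj by (auto simp: hom_def)
    show ?thesis
      using comod[OF x] comod[OF y] L.on_arr_in_hom[OF f] unit.naturality[OF f]
        L.on_arr_Comp[OF f eta[OF y]]
        L.on_arr_Comp[OF eta[OF x] R.on_arr_in_hom[OF L.on_arr_in_hom[OF f]]]
      by (simp add: hom_comodule_cat comparison_def Let_def dc adj_comonad_def)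
  qed
  show "on_arr (comparison B L \<eta>) (Ident B x)
      = Ident (comodule_cat C (adj_comonad L R \<eta> \<epsilon>)) (on_obj (comparison B L \<eta>) x)"
    if "x \<in> Obj B" for x
    using L.A.Id_in_hom[OF that] L.on_arr_Id[OF that]
    by (simp add: comparison_def Let_def hom_def)
  show "on_arr (comparison B L \<eta>) (g \<odot>\<^bsub>B\<^esub> f)
      = on_arr (comparison B L \<eta>) g \<odot>\<^bsub>comodule_cat C (adj_comonad L R \<eta> \<epsilon>)\<^esub> on_arr (comparison B L \<eta>) f"
    if "f \<in> hom B x y" "g \<in> hom B y z" for f g x y z
    using that L.A.Comp_in_hom[OF that] L.on_arr_Comp[OF that]
    by (simp add: comparison_def Let_def hom_def)
qed

end

theory Submission
  imports Defs
begin

text \<open>Let \<open>\<zeta>\<close> be a natural retraction of \<open>\<eta>\<close>. It makes \<open>L\<close> faithful, and a comodule morphism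
  \<open>u : L H \<rightarrow> L H'\<close> is the image of \<open>\<zeta>\<^sub>H' \<odot> R u \<odot> \<eta>\<^sub>H\<close>, so \<open>\<Phi>\<close> is fully faithful. For a comodule
  \<open>(F, h)\<close> the endomorphism \<open>e = \<zeta>\<^sub>R\<^sub>F \<odot> R h\<close> of \<open>R F\<close> is idempotent, and \<open>L e\<close> satisfies
  \<open>L e \<odot> h = h\<close> and \<open>h \<odot> \<epsilon>\<^sub>F \<odot> L e = L e\<close>. Hence, if \<open>e = \<sigma> \<odot> \<rho>\<close> is a splitting through \<open>H\<close>, the
  morphisms \<open>\<epsilon>\<^sub>F \<odot> L \<sigma>\<close> and \<open>L \<rho> \<odot> h\<close> are mutually inverse isomorphisms between \<open>\<Phi> H\<close>
  and \<open>(F, h)\<close>.\<close>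

section \<open>Fully faithful and essentially surjective functors\<close>

lemma (in category) hom_Obj:
  assumes "f \<in> hom C x y"
  shows "x \<in> Obj C" "y \<in> Obj C"
  using assms Dom_in_Obj Cod_in_Obj by (auto simp: hom_def)

lemma cat_functor_id_fun: "category C \<Longrightarrow> cat_functor C C id_fun"
  by (simp add: cat_functor_def cat_functor_axioms_def)

lemma iso_arrI:
  assumes "f \<in> hom C x y" "g \<in> hom C y x"
    and "g \<odot>\<^bsub>C\<^esub> f = Ident C x" "f \<odot>\<^bsub>C\<^esub> g = Ident C y"
  shows "iso_arr C f"
  using assms unfolding iso_arr_def by (auto simp: hom_def)

lemma iso_arrE:
  assumes "iso_arr C f" "f \<in> hom C x y"
  obtains g where "g \<in> hom C y x" "g \<odot>\<^bsub>C\<^esub> f = Ident C x" "f \<odot>\<^bsub>C\<^esub> g = Ident C y"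
  using assms unfolding iso_arr_def by (auto simp: hom_def)

text \<open>A quasi-inverse is built by choice: \<open>g X\<close> is an object whose image is
  joined to \<open>X\<close> by mutually inverse arrows \<open>u X\<close> and \<open>w X\<close>,
  and an arrow goes to the preimage under \<open>F\<close> of its conjugate by these. Equations in
  \<open>A\<close> are checked after applying \<open>F\<close> and then reflected by
  faithfulness.\<close>

lemma (in cat_functor) is_equivalenceI:
  assumes faithful: "\<And>x y f g. f \<in> hom A x y \<Longrightarrow> g \<in> hom A x y \<Longrightarrow> on_arr F f = on_arr F g \<Longrightarrow> f = g"
    and full: "\<And>x y k. x \<in> Obj A \<Longrightarrow> y \<in> Obj A \<Longrightarrow> k \<in> hom B (on_obj F x) (on_obj F y)
      \<Longrightarrow> \<exists>f \<in> hom A x y. on_arr F f = k"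
    and ess_surj: "\<And>X. X \<in> Obj B \<Longrightarrow> \<exists>x \<in> Obj A. \<exists>u \<in> hom B (on_obj F x) X. iso_arr B u"
  shows "is_equivalence A B F"
proof -
  have "\<exists>x u w. x \<in> Obj A \<and> u \<in> hom B (on_obj F x) X \<and> w \<in> hom B X (on_obj F x)
      \<and> w \<odot>\<^bsub>B\<^esub> u = Ident B (on_obj F x) \<and> u \<odot>\<^bsub>B\<^esub> w = Ident B X" if "X \<in> Obj B" for X
    using ess_surj[OF that] by (meson iso_arrE)
  then obtain g u w where
    g: "\<And>X. X \<in> Obj B \<Longrightarrow> g X \<in> Obj A"
    and u: "\<And>X. X \<in> Obj B \<Longrightarrow> u X \<in> hom B (on_obj F (g X)) X"
    and w: "\<And>X. X \<in> Obj B \<Longrightarrow> w X \<in> hom B X (on_obj F (g X))"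
    and wu: "\<And>X. X \<in> Obj B \<Longrightarrow> w X \<odot>\<^bsub>B\<^esub> u X = Ident B (on_obj F (g X))"
    and uw: "\<And>X. X \<in> Obj B \<Longrightarrow> u X \<odot>\<^bsub>B\<^esub> w X = Ident B X"
    by metis
  \<comment> \<open>The arrow part of a functor receives only the arrow, so the endpoints are read
    off with \<open>Dom\<close> and \<open>Cod\<close>; the fact below replaces them by any
    \<open>X\<close> and \<open>Y\<close> with \<open>f \<in> hom B X Y\<close>.\<close>
  define conj where "conj f = w (Cod B f) \<odot>\<^bsub>B\<^esub> (f \<odot>\<^bsub>B\<^esub> u (Dom B f))" for f
  have conj: "conj f = w Y \<odot>\<^bsub>B\<^esub> (f \<odot>\<^bsub>B\<^esub> u X)" "conj f \<in> hom B (on_obj F (g X)) (on_obj F (g Y))"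
    if f: "f \<in> hom B X Y" for f X Y
  proof -
    show *: "conj f = w Y \<odot>\<^bsub>B\<^esub> (f \<odot>\<^bsub>B\<^esub> u X)"
      using f by (auto simp: conj_def hom_def)
    show "conj f \<in> hom B (on_obj F (g X)) (on_obj F (g Y))"
      unfolding * using f u w B.hom_Obj by (meson B.Comp_in_hom)
  qed
  have "\<forall>f \<in> Arr B. \<exists>k. k \<in> hom A (g (Dom B f)) (g (Cod B f)) \<and> on_arr F k = conj f"
  proof
    fix f assume "f \<in> Arr B"
    then have f: "f \<in> hom B (Dom B f) (Cod B f)" by (simp add: hom_def)
    show "\<exists>k. k \<in> hom A (g (Dom B f)) (g (Cod B f)) \<and> on_arr F k = conj f"
      using full[OF g[OF B.hom_Obj(1)[OF f]] g[OF B.hom_Obj(2)[OF f]] conj(2)[OF f]] by blast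
  qed
  then obtain ga where
    "\<And>f. f \<in> Arr B \<Longrightarrow> ga f \<in> hom A (g (Dom B f)) (g (Cod B f)) \<and> on_arr F (ga f) = conj f"
    by metis
  then have ga: "ga f \<in> hom A (g X) (g Y)" and F_ga: "on_arr F (ga f) = w Y \<odot>\<^bsub>B\<^esub> (f \<odot>\<^bsub>B\<^esub> u X)"
    if "f \<in> hom B X Y" for f X Y
    using conj(1)[OF that] that by (auto simp: hom_def)
  \<comment> \<open>The factor \<open>w Y\<close> in the conjugate cancels against
    \<open>u Y\<close>. This is naturality of \<open>u\<close>, and it also makes \<open>ga\<close>
    respect composition.\<close>
  have u_F_ga: "u Y \<odot>\<^bsub>B\<^esub> on_arr F (ga f) = f \<odot>\<^bsub>B\<^esub> u X" if f: "f \<in> hom B X Y" for f X Y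
  proof -
    note X = B.hom_Obj(1)[OF f] and Y = B.hom_Obj(2)[OF f]
    note fu = B.Comp_in_hom[OF u[OF X] f]
    show ?thesis
      using B.Comp_assoc[OF fu w[OF Y] u[OF Y]] by (simp add: F_ga[OF f] uw[OF Y] B.Comp_Id_left[OF fu])
  qed
  define G where "G = \<lparr>on_obj = g, on_arr = ga\<rparr>"
  have G: "cat_functor B A G"
  proof
    show "on_obj G X \<in> Obj A" if "X \<in> Obj B" for X
      using that by (simp add: G_def g)
    show "on_arr G f \<in> hom A (on_obj G X) (on_obj G Y)" if "f \<in> hom B X Y" for f X Y
      using that by (simp add: G_def ga)
    show "on_arr G (Ident B X) = Ident A (on_obj G X)" if X: "X \<in> Obj B" for X
    proof -
      have "on_arr F (ga (Ident B X)) = on_arr F (Ident A (g X))"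
        using F_ga[OF B.Id_in_hom[OF X]] B.Comp_Id_left[OF u[OF X]] wu[OF X] on_arr_Id[OF g[OF X]]
        by simp
      then show ?thesis
        using faithful[OF ga[OF B.Id_in_hom[OF X]] A.Id_in_hom[OF g[OF X]]] by (simp add: G_def)
    qed
    show "on_arr G (k \<odot>\<^bsub>B\<^esub> f) = on_arr G k \<odot>\<^bsub>A\<^esub> on_arr G f"
      if f: "f \<in> hom B X Y" and k: "k \<in> hom B Y Z" for f k X Y Z
    proof -
      note X = B.hom_Obj(1)[OF f] and Y = B.hom_Obj(2)[OF f] and Z = B.hom_Obj(2)[OF k]
      have "on_arr F (ga k \<odot>\<^bsub>A\<^esub> ga f) = (w Z \<odot>\<^bsub>B\<^esub> (k \<odot>\<^bsub>B\<^esub> u Y)) \<odot>\<^bsub>B\<^esub> on_arr F (ga f)"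
        using on_arr_Comp[OF ga[OF f] ga[OF k]] F_ga[OF k] by simp
      also have "\<dots> = w Z \<odot>\<^bsub>B\<^esub> (k \<odot>\<^bsub>B\<^esub> (u Y \<odot>\<^bsub>B\<^esub> on_arr F (ga f)))"
        using B.Comp_assoc[OF on_arr_in_hom[OF ga[OF f]] B.Comp_in_hom[OF u[OF Y] k] w[OF Z]]
          B.Comp_assoc[OF on_arr_in_hom[OF ga[OF f]] u[OF Y] k] by simp
      also have "\<dots> = on_arr F (ga (k \<odot>\<^bsub>B\<^esub> f))"
        using F_ga[OF B.Comp_in_hom[OF f k]] B.Comp_assoc[OF u[OF X] f k] u_F_ga[OF f] by simp
      finally show ?thesis
        using faithful[OF ga[OF B.Comp_in_hom[OF f k]] A.Comp_in_hom[OF ga[OF f] ga[OF k]]]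
        by (simp add: G_def)
    qed
  qed
  \<comment> \<open>The unit of the equivalence at \<open>x\<close> is a lift along \<open>F\<close>
    of \<open>w (on_obj F x)\<close>.\<close>
  have "\<forall>x \<in> Obj A. \<exists>a. a \<in> hom A x (g (on_obj F x)) \<and> on_arr F a = w (on_obj F x)"
    using full g w on_obj_in_Obj by meson
  then obtain \<alpha> where \<alpha>: "\<And>x. x \<in> Obj A \<Longrightarrow> \<alpha> x \<in> hom A x (g (on_obj F x))"
    and F_\<alpha>: "\<And>x. x \<in> Obj A \<Longrightarrow> on_arr F (\<alpha> x) = w (on_obj F x)"
    by metis
  have "nat_iso A A id_fun (G \<circ>\<^sub>F F) \<alpha>"
    unfolding nat_iso_def
  proof (intro conjI nat_trans.intro nat_trans_axioms.intro cat_functor_id_fun A.category_axioms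
      cat_functor_comp[OF cat_functor_axioms G] ballI)
    show "\<alpha> x \<in> hom A (on_obj id_fun x) (on_obj (G \<circ>\<^sub>F F) x)" if "x \<in> Obj A" for x
      using \<alpha>[OF that] by (simp add: G_def)
    show "\<alpha> y \<odot>\<^bsub>A\<^esub> on_arr id_fun f = on_arr (G \<circ>\<^sub>F F) f \<odot>\<^bsub>A\<^esub> \<alpha> x" if f: "f \<in> hom A x y" for f x y
    proof -
      note x = A.hom_Obj(1)[OF f] and y = A.hom_Obj(2)[OF f]
      note Fx = on_obj_in_Obj[OF x] and Fy = on_obj_in_Obj[OF y] and Ff = on_arr_in_hom[OF f]
      note wFf = B.Comp_in_hom[OF Ff w[OF Fy]]
      have "on_arr F (ga (on_arr F f) \<odot>\<^bsub>A\<^esub> \<alpha> x)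
          = ((w (on_obj F y) \<odot>\<^bsub>B\<^esub> on_arr F f) \<odot>\<^bsub>B\<^esub> u (on_obj F x)) \<odot>\<^bsub>B\<^esub> w (on_obj F x)"
        using on_arr_Comp[OF \<alpha>[OF x] ga[OF Ff]] F_ga[OF Ff] F_\<alpha>[OF x]
          B.Comp_assoc[OF u[OF Fx] Ff w[OF Fy]] by simp
      also have "\<dots> = w (on_obj F y) \<odot>\<^bsub>B\<^esub> on_arr F f"
        using B.Comp_assoc[OF w[OF Fx] u[OF Fx] wFf] uw[OF Fx] B.Comp_Id_right[OF wFf] by simp
      also have "\<dots> = on_arr F (\<alpha> y \<odot>\<^bsub>A\<^esub> f)"
        using on_arr_Comp[OF f \<alpha>[OF y]] F_\<alpha>[OF y] by simp
      finally show ?thesis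
        using faithful[OF A.Comp_in_hom[OF f \<alpha>[OF y]] A.Comp_in_hom[OF \<alpha>[OF x] ga[OF Ff]]]
        by (simp add: G_def)
    qed
    show "iso_arr A (\<alpha> x)" if x: "x \<in> Obj A" for x
    proof -
      note Fx = on_obj_in_Obj[OF x]
      \<comment> \<open>The inverse of \<open>\<alpha> x\<close> is a lift of
        \<open>u (on_obj F x)\<close>; both composites are identities because their images under
        \<open>F\<close> are.\<close>
      obtain k where k: "k \<in> hom A (g (on_obj F x)) x" and Fk: "on_arr F k = u (on_obj F x)"
        using full[OF g[OF Fx] x u[OF Fx]] by blast
      have "on_arr F (k \<odot>\<^bsub>A\<^esub> \<alpha> x) = on_arr F (Ident A x)"
        using on_arr_Comp[OF \<alpha>[OF x] k] F_\<alpha>[OF x] Fk uw[OF Fx] on_arr_Id[OF x] by simp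
      moreover have "on_arr F (\<alpha> x \<odot>\<^bsub>A\<^esub> k) = on_arr F (Ident A (g (on_obj F x)))"
        using on_arr_Comp[OF k \<alpha>[OF x]] F_\<alpha>[OF x] Fk wu[OF Fx] on_arr_Id[OF g[OF Fx]] by simp
      ultimately show ?thesis
        by (intro iso_arrI[OF \<alpha>[OF x] k])
          (auto intro: faithful A.Comp_in_hom A.Id_in_hom \<alpha>[OF x] k x g[OF Fx])
    qed
  qed
  moreover have "nat_iso B B (F \<circ>\<^sub>F G) id_fun u"
    unfolding nat_iso_def
  proof (intro conjI nat_trans.intro nat_trans_axioms.intro cat_functor_id_fun B.category_axioms
      cat_functor_comp[OF G cat_functor_axioms] ballI)
    show "u X \<in> hom B (on_obj (F \<circ>\<^sub>F G) X) (on_obj id_fun X)" if "X \<in> Obj B" for X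
      using u[OF that] by (simp add: G_def)
    show "u Y \<odot>\<^bsub>B\<^esub> on_arr (F \<circ>\<^sub>F G) f = on_arr id_fun f \<odot>\<^bsub>B\<^esub> u X" if "f \<in> hom B X Y" for f X Y
      using u_F_ga[OF that] by (simp add: G_def)
    show "iso_arr B (u X)" if "X \<in> Obj B" for X
      using u[OF that] w[OF that] wu[OF that] uw[OF that] by (rule iso_arrI)
  qed
  ultimately show ?thesis
    using G cat_functor_axioms unfolding is_equivalence_def by blast
qed

section \<open>Comodules\<close>

text \<open>With \<open>T\<close> the endofunctor,
  \<open>T g hY = T g hY f g = T g T f hX g = hX g\<close>, so compatibility with the coactions
  passes from an arrow to its inverse. The conclusion concerns \<open>g\<close> because
  compatibility will be easier to verify in the direction opposite to the one wanted.\<close>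

lemma (in comonad) iso_arr_comodule_cat:
  assumes X: "X \<in> comodules C T" and Y: "Y \<in> comodules C T"
    and f: "f \<in> hom C (fst X) (fst Y)" and g: "g \<in> hom C (fst Y) (fst X)"
    and gf: "g \<odot>\<^bsub>C\<^esub> f = Ident C (fst X)" and fg: "f \<odot>\<^bsub>C\<^esub> g = Ident C (fst Y)"
    and f_comm: "on_arr (Endo T) f \<odot>\<^bsub>C\<^esub> snd X = snd Y \<odot>\<^bsub>C\<^esub> f"
  shows "(Y, g, X) \<in> hom (comodule_cat C T) Y X" "iso_arr (comodule_cat C T) (Y, g, X)"
proof -
  have hX: "snd X \<in> hom C (fst X) (on_obj (Endo T) (fst X))"
    and hY: "snd Y \<in> hom C (fst Y) (on_obj (Endo T) (fst Y))"
    and FX: "fst X \<in> Obj C"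
    using X Y by (auto simp: comodules_def)
  note Tf = counit.F.on_arr_in_hom[OF f] and Tg = counit.F.on_arr_in_hom[OF g]
  note Xg = Comp_in_hom[OF g hX]
  have "on_arr (Endo T) g \<odot>\<^bsub>C\<^esub> snd Y = on_arr (Endo T) g \<odot>\<^bsub>C\<^esub> ((snd Y \<odot>\<^bsub>C\<^esub> f) \<odot>\<^bsub>C\<^esub> g)"
    using Comp_assoc[OF g f hY] fg Comp_Id_right[OF hY] by simp
  also have "\<dots> = on_arr (Endo T) (g \<odot>\<^bsub>C\<^esub> f) \<odot>\<^bsub>C\<^esub> (snd X \<odot>\<^bsub>C\<^esub> g)"
    using Comp_assoc[OF g hX Tf] Comp_assoc[OF Xg Tf Tg] f_comm counit.F.on_arr_Comp[OF f g] by simp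
  also have "\<dots> = snd X \<odot>\<^bsub>C\<^esub> g"
    using gf counit.F.on_arr_Id[OF FX] Comp_Id_left[OF Xg] by simp
  finally have g_comm: "on_arr (Endo T) g \<odot>\<^bsub>C\<^esub> snd Y = snd X \<odot>\<^bsub>C\<^esub> g" .
  show *: "(Y, g, X) \<in> hom (comodule_cat C T) Y X"
    using X Y g g_comm by (simp add: hom_comodule_cat)
  have "(X, f, Y) \<in> hom (comodule_cat C T) X Y"
    using X Y f f_comm by (simp add: hom_comodule_cat)
  with * show "iso_arr (comodule_cat C T) (Y, g, X)"
    by (rule iso_arrI) (simp_all add: gf fg)
qed

lemma comparison_simps:
  "on_obj (comparison B L \<eta>) H = (on_obj L H, on_arr L (\<eta> H))"
  "f \<in> hom B x y \<Longrightarrow> on_arr (comparison B L \<eta>) f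
    = ((on_obj L x, on_arr L (\<eta> x)), on_arr L f, (on_obj L y, on_arr L (\<eta> y)))"
  by (auto simp: comparison_def Let_def hom_def)

section \<open>Adjunctions with split unit\<close>

text \<open>Names a witness of \<open>nat_splits\<close>, so that constructions can refer to it. The
  type variables \<open>'a\<close> and \<open>'b\<close> are those of the objects and arrows of
  \<open>B\<close>.\<close>

locale split_adjunction = adjunction +
  fixes \<zeta> :: "'a \<Rightarrow> 'b"
  assumes retraction_nat_trans: "nat_trans B B (R \<circ>\<^sub>F L) id_fun \<zeta>"
    and retraction: "H \<in> Obj B \<Longrightarrow> \<zeta> H \<odot>\<^bsub>B\<^esub> \<eta> H = Ident B H"
begin

section \<open>Components and naturality squares with composite functors unfolded\<close>

lemma eta_in_hom: "H \<in> Obj B \<Longrightarrow> \<eta> H \<in> hom B H (on_obj R (on_obj L H))"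
  using unit.component by simp

lemma zeta_in_hom: "H \<in> Obj B \<Longrightarrow> \<zeta> H \<in> hom B (on_obj R (on_obj L H)) H"
  using nat_trans.component[OF retraction_nat_trans] by simp

lemma eps_in_hom: "F \<in> Obj C \<Longrightarrow> \<epsilon> F \<in> hom C (on_obj L (on_obj R F)) F"
  using counit.component by simp

lemma eta_natural:
  "f \<in> hom B x y \<Longrightarrow> \<eta> y \<odot>\<^bsub>B\<^esub> f = on_arr R (on_arr L f) \<odot>\<^bsub>B\<^esub> \<eta> x"
  using unit.naturality by simp

lemma zeta_natural:
  "f \<in> hom B x y \<Longrightarrow> \<zeta> y \<odot>\<^bsub>B\<^esub> on_arr R (on_arr L f) = f \<odot>\<^bsub>B\<^esub> \<zeta> x"
  using nat_trans.naturality[OF retraction_nat_trans] by simp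

lemma eps_natural:
  "f \<in> hom C x y \<Longrightarrow> \<epsilon> y \<odot>\<^bsub>C\<^esub> on_arr L (on_arr R f) = f \<odot>\<^bsub>C\<^esub> \<epsilon> x"
  using counit.naturality by simp

section \<open>Faithfulness of the left adjoint and fullness on comodule morphisms\<close>

lemma L_retraction:
  assumes H: "H \<in> Obj B"
  shows "on_arr L (\<zeta> H) \<odot>\<^bsub>C\<^esub> on_arr L (\<eta> H) = Ident C (on_obj L H)"
  using L.on_arr_Comp[OF eta_in_hom[OF H] zeta_in_hom[OF H]] retraction[OF H] L.on_arr_Id[OF H]
  by simp

text \<open>An arrow \<open>k\<close> is recovered from \<open>L k\<close>: naturality of
  \<open>\<eta>\<close> turns \<open>\<zeta> R(L k) \<eta>\<close> into
  \<open>\<zeta> \<eta> k\<close>, which is \<open>k\<close>.\<close>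

lemma L_faithful:
  assumes f: "f \<in> hom B x y" and g: "g \<in> hom B x y" and eq: "on_arr L f = on_arr L g"
  shows "f = g"
proof -
  note y = L.A.hom_Obj(2)[OF f]
  have recover: "\<zeta> y \<odot>\<^bsub>B\<^esub> (on_arr R (on_arr L k) \<odot>\<^bsub>B\<^esub> \<eta> x) = k" if k: "k \<in> hom B x y" for k
    using L.A.Comp_assoc[OF k eta_in_hom[OF y] zeta_in_hom[OF y]] eta_natural[OF k] retraction[OF y]
      L.A.Comp_Id_left[OF k] by simp
  show ?thesis
    using recover f g eq by metis
qed

text \<open>The recovery formula of \<open>L_faithful\<close>, with \<open>k\<close> in place of
  \<open>L f\<close>, gives the preimage. The hypothesis \<open>k_comm\<close> is compatibility with
  the coactions of the comparison objects; it moves \<open>L \<eta>\<close> to the left of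
  \<open>k\<close>, where \<open>L \<zeta>\<close> cancels it.\<close>

lemma L_full_on_comodules:
  assumes x: "x \<in> Obj B" and y: "y \<in> Obj B" and k: "k \<in> hom C (on_obj L x) (on_obj L y)"
    and k_comm: "on_arr L (on_arr R k) \<odot>\<^bsub>C\<^esub> on_arr L (\<eta> x) = on_arr L (\<eta> y) \<odot>\<^bsub>C\<^esub> k"
  shows "\<exists>f \<in> hom B x y. on_arr L f = k"
proof
  note Rk = R.on_arr_in_hom[OF k]
  note Rk_eta = L.A.Comp_in_hom[OF eta_in_hom[OF x] Rk]
  show "\<zeta> y \<odot>\<^bsub>B\<^esub> (on_arr R k \<odot>\<^bsub>B\<^esub> \<eta> x) \<in> hom B x y"
    by (rule L.A.Comp_in_hom[OF Rk_eta zeta_in_hom[OF y]])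
  have "on_arr L (\<zeta> y \<odot>\<^bsub>B\<^esub> (on_arr R k \<odot>\<^bsub>B\<^esub> \<eta> x)) = on_arr L (\<zeta> y) \<odot>\<^bsub>C\<^esub> (on_arr L (\<eta> y) \<odot>\<^bsub>C\<^esub> k)"
    using L.on_arr_Comp[OF Rk_eta zeta_in_hom[OF y]] L.on_arr_Comp[OF eta_in_hom[OF x] Rk] k_comm
    by simp
  also have "\<dots> = k"
    using L.B.Comp_assoc[OF k L.on_arr_in_hom[OF eta_in_hom[OF y]] L.on_arr_in_hom[OF zeta_in_hom[OF y]]]
      L_retraction[OF y] L.B.Comp_Id_left[OF k] by simp
  finally show "on_arr L (\<zeta> y \<odot>\<^bsub>B\<^esub> (on_arr R k \<odot>\<^bsub>B\<^esub> \<eta> x)) = k" .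
qed

section \<open>The idempotent attached to a comodule; the assumptions unfold membership of
  \<open>(F, h)\<close> in \<open>comodules\<close>\<close>

context
  fixes F h
  assumes F: "F \<in> Obj C" and h: "h \<in> hom C F (on_obj L (on_obj R F))"
    and counital: "\<epsilon> F \<odot>\<^bsub>C\<^esub> h = Ident C F"
    and coassociative: "on_arr L (on_arr R h) \<odot>\<^bsub>C\<^esub> h = on_arr L (\<eta> (on_obj R F)) \<odot>\<^bsub>C\<^esub> h"
begin

text \<open>A splitting of this endomorphism is an equalizer of \<open>R h\<close> and
  \<open>\<eta>\<close> at \<open>R F\<close>, the object that comonadic descent assigns to
  \<open>(F, h)\<close>. For a comparison object with underlying \<open>H\<close>, it is
  \<open>\<eta> H\<close> after \<open>\<zeta> H\<close>.\<close>

definition comodule_projector where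
  "comodule_projector = \<zeta> (on_obj R F) \<odot>\<^bsub>B\<^esub> on_arr R h"

private lemmas RF = R.on_obj_in_Obj[OF F]
private lemmas LRF = L.on_obj_in_Obj[OF RF]
private lemmas RLRF = R.on_obj_in_Obj[OF LRF]
private lemmas Rh = R.on_arr_in_hom[OF h]
private lemmas LRh = L.on_arr_in_hom[OF Rh]
private lemmas RLRh = R.on_arr_in_hom[OF LRh]
private lemmas eta = eta_in_hom[OF RF]
private lemmas Leta = L.on_arr_in_hom[OF eta]
private lemmas zeta = zeta_in_hom[OF RF]
private lemmas Lzeta = L.on_arr_in_hom[OF zeta]

lemma comodule_projector_in_hom: "comodule_projector \<in> hom B (on_obj R F) (on_obj R F)"
  unfolding comodule_projector_def by (rule L.A.Comp_in_hom[OF Rh zeta])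

text \<open>The image of the projector lies where \<open>R h\<close> and \<open>\<eta>\<close>
  agree. Naturality of \<open>\<zeta>\<close> at \<open>R h\<close> brings two copies of the
  coaction together, coassociativity trades one for \<open>L \<eta>\<close>, and naturality of
  \<open>\<zeta>\<close> at \<open>\<eta>\<close> moves it back out. Idempotence and
  \<open>coaction_counit_L_comodule_projector\<close> both rest on this.\<close>

lemma coaction_comodule_projector:
  "on_arr R h \<odot>\<^bsub>B\<^esub> comodule_projector = \<eta> (on_obj R F) \<odot>\<^bsub>B\<^esub> comodule_projector"
proof -
  note zeta' = zeta_in_hom[OF RLRF]
  have "on_arr R h \<odot>\<^bsub>B\<^esub> comodule_projector
      = \<zeta> (on_obj R (on_obj L (on_obj R F))) \<odot>\<^bsub>B\<^esub> (on_arr R (on_arr L (on_arr R h)) \<odot>\<^bsub>B\<^esub> on_arr R h)"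
    unfolding comodule_projector_def
    using L.A.Comp_assoc[OF Rh zeta Rh] zeta_natural[OF Rh] L.A.Comp_assoc[OF Rh RLRh zeta'] by simp
  also have "\<dots> = \<zeta> (on_obj R (on_obj L (on_obj R F)))
      \<odot>\<^bsub>B\<^esub> (on_arr R (on_arr L (\<eta> (on_obj R F))) \<odot>\<^bsub>B\<^esub> on_arr R h)"
    using R.on_arr_Comp[OF h LRh] R.on_arr_Comp[OF h Leta] coassociative by simp
  also have "\<dots> = \<eta> (on_obj R F) \<odot>\<^bsub>B\<^esub> comodule_projector"
    unfolding comodule_projector_def
    using L.A.Comp_assoc[OF Rh R.on_arr_in_hom[OF Leta] zeta'] zeta_natural[OF eta]
      L.A.Comp_assoc[OF Rh zeta eta] by simp
  finally show ?thesis .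
qed

lemma comodule_projector_idem: "comodule_projector \<odot>\<^bsub>B\<^esub> comodule_projector = comodule_projector"
proof -
  note e = comodule_projector_in_hom
  have "comodule_projector \<odot>\<^bsub>B\<^esub> comodule_projector
      = \<zeta> (on_obj R F) \<odot>\<^bsub>B\<^esub> (on_arr R h \<odot>\<^bsub>B\<^esub> comodule_projector)"
    using L.A.Comp_assoc[OF e Rh zeta] by (simp add: comodule_projector_def)
  also have "\<dots> = comodule_projector"
    unfolding coaction_comodule_projector
    using L.A.Comp_assoc[OF e eta zeta] retraction[OF RF] L.A.Comp_Id_left[OF e] by simp
  finally show ?thesis .
qed

text \<open>Coassociativity replaces \<open>L (R h)\<close> by \<open>L \<eta>\<close> in front of
  \<open>h\<close>, and \<open>L \<zeta>\<close> then cancels it.\<close>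

lemma L_comodule_projector_coaction: "on_arr L comodule_projector \<odot>\<^bsub>C\<^esub> h = h"
proof -
  have "on_arr L comodule_projector \<odot>\<^bsub>C\<^esub> h = on_arr L (\<zeta> (on_obj R F)) \<odot>\<^bsub>C\<^esub> (on_arr L (on_arr R h) \<odot>\<^bsub>C\<^esub> h)"
    unfolding comodule_projector_def
    using L.on_arr_Comp[OF Rh zeta] L.B.Comp_assoc[OF h LRh Lzeta] by simp
  also have "\<dots> = h"
    unfolding coassociative
    using L.B.Comp_assoc[OF h Leta Lzeta] L_retraction[OF RF] L.B.Comp_Id_left[OF h] by simp
  finally show ?thesis .
qed

text \<open>Naturality of \<open>\<epsilon>\<close> at \<open>h\<close> produces
  \<open>L (R h)\<close> next to the projector, where it may be replaced by \<open>L \<eta>\<close>;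
  a triangle identity removes the rest.\<close>

lemma coaction_counit_L_comodule_projector:
  "(h \<odot>\<^bsub>C\<^esub> \<epsilon> F) \<odot>\<^bsub>C\<^esub> on_arr L comodule_projector = on_arr L comodule_projector"
proof -
  note e = comodule_projector_in_hom and eps = eps_in_hom[OF LRF]
  note Le = L.on_arr_in_hom[OF e]
  have "(h \<odot>\<^bsub>C\<^esub> \<epsilon> F) \<odot>\<^bsub>C\<^esub> on_arr L comodule_projector
      = \<epsilon> (on_obj L (on_obj R F)) \<odot>\<^bsub>C\<^esub> on_arr L (on_arr R h \<odot>\<^bsub>B\<^esub> comodule_projector)"
    using eps_natural[OF h] L.B.Comp_assoc[OF Le LRh eps] L.on_arr_Comp[OF e Rh] by simp
  also have "\<dots> = (\<epsilon> (on_obj L (on_obj R F)) \<odot>\<^bsub>C\<^esub> on_arr L (\<eta> (on_obj R F)))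
      \<odot>\<^bsub>C\<^esub> on_arr L comodule_projector"
    unfolding coaction_comodule_projector
    using L.on_arr_Comp[OF e eta] L.B.Comp_assoc[OF Le Leta eps] by simp
  also have "\<dots> = on_arr L comodule_projector"
    using triangle_left[OF RF] L.B.Comp_Id_left[OF Le] by simp
  finally show ?thesis .
qed

text \<open>One composite reduces to \<open>\<epsilon> F\<close> after \<open>h\<close> because
  \<open>L \<sigma>\<close> after \<open>L \<rho>\<close> is the image of the projector, which fixes
  \<open>h\<close>; the other reduces to \<open>\<rho> \<sigma>\<close> once \<open>h\<close> after
  \<open>a\<close> is known to be \<open>L \<sigma>\<close>.\<close>

lemma comodule_iso_if_projector_splits:
  assumes \<sigma>: "\<sigma> \<in> hom B H (on_obj R F)" and \<rho>: "\<rho> \<in> hom B (on_obj R F) H"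
    and \<rho>\<sigma>: "\<rho> \<odot>\<^bsub>B\<^esub> \<sigma> = Ident B H" and \<sigma>\<rho>: "\<sigma> \<odot>\<^bsub>B\<^esub> \<rho> = comodule_projector"
  defines "a \<equiv> \<epsilon> F \<odot>\<^bsub>C\<^esub> on_arr L \<sigma>" and "b \<equiv> on_arr L \<rho> \<odot>\<^bsub>C\<^esub> h"
  shows "a \<in> hom C (on_obj L H) F" "b \<in> hom C F (on_obj L H)"
    and "a \<odot>\<^bsub>C\<^esub> b = Ident C F" "b \<odot>\<^bsub>C\<^esub> a = Ident C (on_obj L H)"
    and "on_arr L (on_arr R b) \<odot>\<^bsub>C\<^esub> h = on_arr L (\<eta> H) \<odot>\<^bsub>C\<^esub> b"
proof -
  note H = L.A.hom_Obj(1)[OF \<sigma>]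
  note eps = eps_in_hom[OF F]
  note L\<sigma> = L.on_arr_in_hom[OF \<sigma>] and L\<rho> = L.on_arr_in_hom[OF \<rho>]
  note LetaH = L.on_arr_in_hom[OF eta_in_hom[OF H]]
  note RL\<rho> = R.on_arr_in_hom[OF L\<rho>]
  note LRL\<rho> = L.on_arr_in_hom[OF RL\<rho>]
  have Le: "on_arr L comodule_projector = on_arr L \<sigma> \<odot>\<^bsub>C\<^esub> on_arr L \<rho>"
    using L.on_arr_Comp[OF \<rho> \<sigma>] \<sigma>\<rho> by simp
  have L\<rho>\<sigma>: "on_arr L \<rho> \<odot>\<^bsub>C\<^esub> on_arr L \<sigma> = Ident C (on_obj L H)"
    using L.on_arr_Comp[OF \<sigma> \<rho>] \<rho>\<sigma> L.on_arr_Id[OF H] by simp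
  show a: "a \<in> hom C (on_obj L H) F"
    unfolding a_def by (rule L.B.Comp_in_hom[OF L\<sigma> eps])
  show b: "b \<in> hom C F (on_obj L H)"
    unfolding b_def by (rule L.B.Comp_in_hom[OF h L\<rho>])
  have "a \<odot>\<^bsub>C\<^esub> b = \<epsilon> F \<odot>\<^bsub>C\<^esub> (on_arr L comodule_projector \<odot>\<^bsub>C\<^esub> h)"
    using L.B.Comp_assoc[OF b L\<sigma> eps] L.B.Comp_assoc[OF h L\<rho> L\<sigma>] Le by (simp add: a_def b_def)
  then show "a \<odot>\<^bsub>C\<^esub> b = Ident C F"
    using L_comodule_projector_coaction counital by simp
  have Le_\<sigma>: "on_arr L comodule_projector \<odot>\<^bsub>C\<^esub> on_arr L \<sigma> = on_arr L \<sigma>"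
    using L.B.Comp_assoc[OF L\<sigma> L\<rho> L\<sigma>] Le L\<rho>\<sigma> L.B.Comp_Id_right[OF L\<sigma>] by simp
  \<comment> \<open>The projector fixes \<open>\<sigma>\<close>, so it can be inserted before
    \<open>\<epsilon> F\<close>, where it absorbs \<open>h\<close> after
    \<open>\<epsilon> F\<close>.\<close>
  have "h \<odot>\<^bsub>C\<^esub> a = (h \<odot>\<^bsub>C\<^esub> \<epsilon> F) \<odot>\<^bsub>C\<^esub> (on_arr L comodule_projector \<odot>\<^bsub>C\<^esub> on_arr L \<sigma>)"
    using L.B.Comp_assoc[OF L\<sigma> eps h] Le_\<sigma> by (simp add: a_def)
  also have "\<dots> = on_arr L \<sigma>"
    using L.B.Comp_assoc[OF L\<sigma> L.on_arr_in_hom[OF comodule_projector_in_hom] L.B.Comp_in_hom[OF eps h]]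
      coaction_counit_L_comodule_projector Le_\<sigma> by simp
  finally show "b \<odot>\<^bsub>C\<^esub> a = Ident C (on_obj L H)"
    using L.B.Comp_assoc[OF a h L\<rho>] L\<rho>\<sigma> by (simp add: b_def)
  \<comment> \<open>Compatibility of \<open>b\<close> with the coactions combines coassociativity of
    \<open>h\<close> with naturality of \<open>\<eta>\<close> at \<open>\<rho>\<close>.\<close>
  have "on_arr L (on_arr R b) \<odot>\<^bsub>C\<^esub> h
      = on_arr L (on_arr R (on_arr L \<rho>)) \<odot>\<^bsub>C\<^esub> (on_arr L (\<eta> (on_obj R F)) \<odot>\<^bsub>C\<^esub> h)"
    using R.on_arr_Comp[OF h L\<rho>] L.on_arr_Comp[OF Rh RL\<rho>] L.B.Comp_assoc[OF h LRh LRL\<rho>] coassociative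
    by (simp add: b_def)
  also have "\<dots> = on_arr L (\<eta> H \<odot>\<^bsub>B\<^esub> \<rho>) \<odot>\<^bsub>C\<^esub> h"
    using L.B.Comp_assoc[OF h Leta LRL\<rho>] L.on_arr_Comp[OF eta RL\<rho>] eta_natural[OF \<rho>] by simp
  also have "\<dots> = on_arr L (\<eta> H) \<odot>\<^bsub>C\<^esub> b"
    using L.on_arr_Comp[OF \<rho> eta_in_hom[OF H]] L.B.Comp_assoc[OF h L\<rho> LetaH] by (simp add: b_def)
  finally show "on_arr L (on_arr R b) \<odot>\<^bsub>C\<^esub> h = on_arr L (\<eta> H) \<odot>\<^bsub>C\<^esub> b" .
qed

end

section \<open>The comparison functor as an equivalence\<close>

theorem comparison_is_equivalence:
  assumes "karoubian_complete B"
  shows "is_equivalence B (comodule_cat C (adj_comonad L R \<eta> \<epsilon>)) (comparison B L \<eta>)"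
proof (rule cat_functor.is_equivalenceI[OF cat_functor_comparison])
  let ?T = "adj_comonad L R \<eta> \<epsilon>" and ?\<Phi> = "comparison B L \<eta>"
  show "f = g" if "f \<in> hom B x y" "g \<in> hom B x y" "on_arr ?\<Phi> f = on_arr ?\<Phi> g" for x y f g
    using that by (simp add: comparison_simps(2) L_faithful)
  show "\<exists>f \<in> hom B x y. on_arr ?\<Phi> f = k"
    if x: "x \<in> Obj B" and y: "y \<in> Obj B"
      and k: "k \<in> hom (comodule_cat C ?T) (on_obj ?\<Phi> x) (on_obj ?\<Phi> y)" for x y k
  proof -
    \<comment> \<open>The outer entries of the triple \<open>k\<close> are fixed by its source and
      target, so lifting \<open>k\<close> amounts to lifting its middle entry.\<close>
    obtain k' where k': "k = (on_obj ?\<Phi> x, k', on_obj ?\<Phi> y)"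
      and hom: "k' \<in> hom C (on_obj L x) (on_obj L y)"
      and comm: "on_arr L (on_arr R k') \<odot>\<^bsub>C\<^esub> on_arr L (\<eta> x) = on_arr L (\<eta> y) \<odot>\<^bsub>C\<^esub> k'"
      using k by (auto simp: hom_comodule_cat comparison_simps adj_comonad_def)
    then obtain f where "f \<in> hom B x y" "on_arr L f = k'"
      using L_full_on_comodules[OF x y hom comm] by blast
    then show ?thesis
      using k' by (auto simp: comparison_simps)
  qed
  show "\<exists>H \<in> Obj B. \<exists>u \<in> hom (comodule_cat C ?T) (on_obj ?\<Phi> H) X. iso_arr (comodule_cat C ?T) u"
    if "X \<in> Obj (comodule_cat C ?T)" for X
  proof -
    obtain F h where X: "X = (F, h)" by fastforce
    have comod: "(F, h) \<in> comodules C ?T" using that X by simp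
    then have *: "F \<in> Obj C" "h \<in> hom C F (on_obj L (on_obj R F))" "\<epsilon> F \<odot>\<^bsub>C\<^esub> h = Ident C F"
      "on_arr L (on_arr R h) \<odot>\<^bsub>C\<^esub> h = on_arr L (\<eta> (on_obj R F)) \<odot>\<^bsub>C\<^esub> h"
      by (simp_all add: comodules_def adj_comonad_def)
    obtain H \<sigma> \<rho> where H: "H \<in> Obj B" and split: "\<sigma> \<in> hom B H (on_obj R F)" "\<rho> \<in> hom B (on_obj R F) H"
        "\<rho> \<odot>\<^bsub>B\<^esub> \<sigma> = Ident B H" "\<sigma> \<odot>\<^bsub>B\<^esub> \<rho> = comodule_projector F h"
      using assms R.on_obj_in_Obj[OF *(1)] comodule_projector_in_hom[OF *] comodule_projector_idem[OF *]
      unfolding karoubian_complete_def by meson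
    have \<Phi>H: "on_obj ?\<Phi> H \<in> comodules C ?T"
      using cat_functor.on_obj_in_Obj[OF cat_functor_comparison H] by simp
    note iso = comodule_iso_if_projector_splits[OF * split]
    show ?thesis
      \<comment> \<open>Compatibility is known for \<open>b\<close>, from \<open>(F, h)\<close> to
        the image of \<open>H\<close>; the lemma transfers it to the inverse, which has the
        direction required here.\<close>
      using comonad.iso_arr_comodule_cat[OF comonad_adj_comonad comod \<Phi>H, of
          "on_arr L \<rho> \<odot>\<^bsub>C\<^esub> h" "\<epsilon> F \<odot>\<^bsub>C\<^esub> on_arr L \<sigma>"] iso H X
      by (auto simp: comparison_simps adj_comonad_def)
  qed
qed

end

theorem corollary3p11:
  fixes B :: "('ob, 'mb) cat" and C :: "('oc, 'mc) cat"
    and Pstar :: "('ob, 'mb, 'oc, 'mc) cfun"  \<comment> \<open>the left adjoint\<close>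
    and Plow :: "('oc, 'mc, 'ob, 'mb) cfun"  \<comment> \<open>the right adjoint\<close>
    and \<eta> :: "'ob \<Rightarrow> 'mb" and \<epsilon> :: "'oc \<Rightarrow> 'mc"
  assumes "adjunction B C Pstar Plow \<eta> \<epsilon>"
    and "karoubian_complete B"
    and "nat_splits B B id_fun (Plow \<circ>\<^sub>F Pstar) \<eta>"
  shows "is_equivalence B (comodule_cat C (adj_comonad Pstar Plow \<eta> \<epsilon>)) (comparison B Pstar \<eta>)"
proof -
  \<comment> \<open>A chosen retraction places the adjunction in the locale
    \<open>split_adjunction\<close>.\<close>
  obtain \<zeta> where "nat_trans B B (Plow \<circ>\<^sub>F Pstar) id_fun \<zeta>"
    and "\<forall>H \<in> Obj B. \<zeta> H \<odot>\<^bsub>B\<^esub> \<eta> H = Ident B H"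
    using assms(3) by (auto simp: nat_splits_def)
  then have "split_adjunction B C Pstar Plow \<eta> \<epsilon> \<zeta>"
    using assms(1) by (simp add: split_adjunction_def split_adjunction_axioms_def)
  then show ?thesis
    using assms(2) by (rule split_adjunction.comparison_is_equivalence)
qed

end
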